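(* Let $G=(V,E)$ be a finite graph. Choosing $A,B\subseteq E$ independently and uniformly at random, the event that $|A|+|B|\equiv 0$ or $1 \pmod 4$ (i.e. that $\left\lfloor\frac{|A|+|B|}{2}\right\rfloor$ is even) is correlated with the event $\Delta$ that $A\bigtriangleup B$ is eulerian in the following way: $$\frac{\mathrm{Bias}(|A|+|B|\equiv 0,1\ (\mathrm{mod}\ 4)\,\mid\,\Delta)}{\mathrm{Bias}(|A|+|B|\equiv 0,1\ (\mathrm{mod}\ 4))}=2^{r(G)}F(G;2).$$
   Context: Graphs are finite; loops and parallel edges are permitted. A subset $A\subseteq E$ is identified with the subgraph $(V,A)$ of $G$; it is called eulerian if all its vertex degrees are even (a loop contributes 2 to the degree). $\bigtriangleup$ is symmetric difference of sets. $r(G)=|V|-k(G)$, where $k(G)$ is the number of connected components of $G$. $F(G;q)$ is the number of nowhere-zero $\mathbb{Z}_q$-flows of $G$ (with respect to any fixed orientation). For an event $\Sigma$, $\mathrm{Bias}(\Sigma)=\mathbb{P}(\Sigma)-\mathbb{P}(\overline{\Sigma})$ and $\mathrm{Bias}(\Sigma\mid\Delta)=\mathbb{P}(\Sigma\mid\Delta)-\mathbb{P}(\overline{\Sigma}\mid\Delta)$, where $\overline{\Sigma}$ is the complement of $\Sigma$. *)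

theory Defs
  imports "HOL-Probability.Probability"
begin

text \<open>Finite undirected graphs with vertex set \<open>V\<close> and edge set \<open>E\<close>. The set \<open>ends e\<close> of end
  vertices of an edge is a doubleton, or a singleton if \<open>e\<close> is a loop; \<open>ends\<close> need not be
  injective, so parallel edges are allowed.\<close>

locale finite_multigraph =
  fixes V :: "'v set" and E :: "'e set" and ends :: "'e \<Rightarrow> 'v set"
  assumes finite_V: "finite V"
    and finite_E: "finite E"
    and ends_V: "\<And>e. e \<in> E \<Longrightarrow> ends e \<subseteq> V \<and> (card (ends e) = 1 \<or> card (ends e) = 2)"

text \<open>Degree of \<open>v\<close> in the spanning subgraph \<open>(V, A)\<close>; the second summand counts loops
  once more.\<close>

definition degree :: "('e \<Rightarrow> 'v set) \<Rightarrow> 'e set \<Rightarrow> 'v \<Rightarrow> nat" where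
  "degree ends A v = card {e \<in> A. v \<in> ends e} + card {e \<in> A. ends e = {v}}"

definition eulerian :: "'v set \<Rightarrow> ('e \<Rightarrow> 'v set) \<Rightarrow> 'e set \<Rightarrow> bool" where
  "eulerian V ends A \<longleftrightarrow> (\<forall>v\<in>V. even (degree ends A v))"

definition connected_rel :: "'v set \<Rightarrow> 'e set \<Rightarrow> ('e \<Rightarrow> 'v set) \<Rightarrow> ('v \<times> 'v) set" where
  "connected_rel V E ends = {(u, v). \<exists>e\<in>E. ends e = {u, v}}\<^sup>* \<inter> V \<times> V"

definition num_components :: "'v set \<Rightarrow> 'e set \<Rightarrow> ('e \<Rightarrow> 'v set) \<Rightarrow> nat" where
  "num_components V E ends = card (V // connected_rel V E ends)"

text \<open>The subtraction does not truncate: a finite graph has at most \<open>card V\<close> components.\<close>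

definition graph_rank :: "'v set \<Rightarrow> 'e set \<Rightarrow> ('e \<Rightarrow> 'v set) \<Rightarrow> nat" where
  "graph_rank V E ends = card V - num_components V E ends"

definition orientation ::
  "'e set \<Rightarrow> ('e \<Rightarrow> 'v set) \<Rightarrow> ('e \<Rightarrow> 'v) \<Rightarrow> ('e \<Rightarrow> 'v) \<Rightarrow> bool" where
  "orientation E ends tail head \<longleftrightarrow> (\<forall>e\<in>E. ends e = {tail e, head e})"

text \<open>Elements of \<open>\<int>\<^sub>q\<close> are represented by their residues in \<open>{0..<q}\<close>; flows are extensional
  functions on \<open>E\<close>, so that each flow is counted once.\<close>

definition nowhere_zero_flows ::
  "'v set \<Rightarrow> 'e set \<Rightarrow> ('e \<Rightarrow> 'v) \<Rightarrow> ('e \<Rightarrow> 'v) \<Rightarrow> nat \<Rightarrow> ('e \<Rightarrow> int) set" where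
  "nowhere_zero_flows V E tail head q =
     {f \<in> E \<rightarrow>\<^sub>E {0..<int q}.
        (\<forall>e\<in>E. f e \<noteq> 0) \<and>
        (\<forall>v\<in>V. (\<Sum>e | e \<in> E \<and> tail e = v. f e) mod int q =
               (\<Sum>e | e \<in> E \<and> head e = v. f e) mod int q)}"

definition num_nowhere_zero_flows ::
  "'v set \<Rightarrow> 'e set \<Rightarrow> ('e \<Rightarrow> 'v) \<Rightarrow> ('e \<Rightarrow> 'v) \<Rightarrow> nat \<Rightarrow> nat" where
  "num_nowhere_zero_flows V E tail head q = card (nowhere_zero_flows V E tail head q)"

definition bias :: "'a measure \<Rightarrow> ('a \<Rightarrow> bool) \<Rightarrow> real" where
  "bias M S = \<P>(x in M. S x) - \<P>(x in M. \<not> S x)"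

definition cond_bias :: "'a measure \<Rightarrow> ('a \<Rightarrow> bool) \<Rightarrow> ('a \<Rightarrow> bool) \<Rightarrow> real" where
  "cond_bias M S D = \<P>(x in M. S x \<bar> D x) - \<P>(x in M. \<not> S x \<bar> D x)"

definition random_edge_sets :: "'e set \<Rightarrow> ('e set \<times> 'e set) pmf" where
  "random_edge_sets E = pair_pmf (pmf_of_set (Pow E)) (pmf_of_set (Pow E))"

end

theory Submission
  imports Defs
begin

text \<open>For a fixed \<open>C \<subseteq> E\<close>, sum the sign of the event \<open>|A| + |B| \<equiv> 0, 1 (mod 4)\<close> over the pairs with
  \<open>sym_diff A B = C\<close>. If some edge lies outside \<open>C\<close>, switching it in both \<open>A\<close> and \<open>B\<close> changes
  \<open>|A| + |B|\<close> by 2 and the sum cancels; so only \<open>C = E\<close> contributes, with \<open>|A| + |B| = |E|\<close>. Hence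
  the quotient of the two biases is \<open>2 ^ |E|\<close> divided by the number of eulerian sets if \<open>E\<close> is
  eulerian, and 0 otherwise. The number of eulerian sets is \<open>2 ^ (|E| - r(G))\<close>, by evaluating the
  double sum of \<open>(-1) ^ |A \<inter> \<delta>(X)|\<close> over \<open>A \<subseteq> E\<close> and \<open>X \<subseteq> V\<close> in both orders, where \<open>\<delta>(X)\<close> is the
  cut of \<open>X\<close>.\<close>

section \<open>Biases of uniform random variables\<close>

lemma pair_pmf_of_set:
  assumes "finite A" "A \<noteq> {}" "finite B" "B \<noteq> {}"
  shows "pair_pmf (pmf_of_set A) (pmf_of_set B) = pmf_of_set (A \<times> B)"
  using assms by (intro pmf_eqI)
    (simp add: split_paired_all pmf_pair pmf_of_set card_cartesian_product indicator_def)

lemma bias_pmf_of_set: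
  assumes "finite S" "S \<noteq> {}"
  shows "bias (pmf_of_set S) P = (\<Sum>x\<in>S. if P x then 1 else - 1) / real (card S)"
proof -
  have "(\<Sum>x\<in>S. if P x then 1 else - 1 :: real) =
      real (card (S \<inter> {x. P x})) - real (card (S \<inter> {x. \<not> P x}))"
    using assms by (simp add: sum.If_cases Compl_eq)
  then show ?thesis
    using assms by (simp add: bias_def measure_pmf_of_set diff_divide_distrib)
qed

text \<open>Conditioning a uniform variable on \<open>D\<close> makes it uniform on the points
  satisfying \<open>D\<close>. If there are none, both sides are 0 by division by zero, so the final
  theorem states separately that \<open>\<Delta>\<close> has positive probability.\<close>

lemma cond_bias_pmf_of_set:
  assumes "finite S" "S \<noteq> {}"
  shows "cond_bias (pmf_of_set S) P D =
    (\<Sum>x\<in>{x \<in> S. D x}. if P x then 1 else - 1) / real (card {x \<in> S. D x})"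
proof -
  let ?T = "{x \<in> S. D x}"
  have "(\<Sum>x\<in>?T. if P x then 1 else - 1 :: real) =
      real (card (?T \<inter> {x. P x})) - real (card (?T \<inter> {x. \<not> P x}))"
    using assms by (simp add: sum.If_cases Compl_eq)
  moreover have "S \<inter> {x. Q x \<and> D x} = ?T \<inter> {x. Q x}" "S \<inter> {x. D x} = ?T" for Q
    by auto
  ultimately show ?thesis
    using assms by (simp add: cond_bias_def cond_prob_def measure_pmf_of_set diff_divide_distrib)
qed

section \<open>The sign sum over pairs with a given symmetric difference\<close>

abbreviation floor_half_sign :: "nat \<Rightarrow> real" where
  "floor_half_sign n \<equiv> if n mod 4 \<in> {0, 1} then 1 else - 1"

lemma floor_half_sign_add_2: "floor_half_sign (n + 2) = - floor_half_sign n"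
proof -
  have "n mod 4 = 0 \<or> n mod 4 = 1 \<or> n mod 4 = 2 \<or> n mod 4 = 3" by linarith
  moreover have "(n + 2) mod 4 = (n mod 4 + 2) mod 4" by (simp add: mod_simps)
  ultimately show ?thesis by auto
qed

lemma sum_Pow_split:
  fixes f :: "'a set \<Rightarrow> 'b::comm_monoid_add"
  assumes "finite E" "e \<in> E"
  shows "sum f (Pow E) = (\<Sum>A\<in>Pow (E - {e}). f A + f (insert e A))"
proof -
  have E: "Pow E = Pow (E - {e}) \<union> insert e ` Pow (E - {e})"
    using assms Pow_insert[of e "E - {e}"] by (simp add: insert_absorb)
  have "inj_on (insert e) (Pow (E - {e}))"
    by (rule inj_onI) blast
  then show ?thesis
    unfolding E using assms
    by (subst sum.union_disjoint) (auto simp: sum.reindex sum.distrib)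
qed

lemma sum_floor_half_sign_sym_diff:
  assumes "finite E" "C \<subseteq> E"
  shows "(\<Sum>A\<in>Pow E. floor_half_sign (card A + card (sym_diff A C))) =
    (if C = E then 2 ^ card E * floor_half_sign (card E) else 0)"
proof (cases "C = E")
  case True
  \<comment> \<open>Here \<open>B\<close> is the complement of \<open>A\<close> in \<open>E\<close>,
    so every term has the same sign.\<close>
  have "card A + card (sym_diff A E) = card E" if "A \<in> Pow E" for A
  proof -
    have "sym_diff A E = E - A" using that by auto
    then show ?thesis
      using that assms by (simp add: card_Diff_subset finite_subset card_mono)
  qed
  then show ?thesis
    using True assms by (simp add: card_Pow)
next
  case False
  then obtain e where e: "e \<in> E" "e \<notin> C" using assms by auto
  have "floor_half_sign (card A + card (sym_diff A C)) +
      floor_half_sign (card (insert e A) + card (sym_diff (insert e A) C)) = 0"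
    if "A \<in> Pow (E - {e})" for A
  proof -
    have fin: "finite A" "finite C" "e \<notin> A"
      using that assms by (auto intro: finite_subset)
    have "sym_diff (insert e A) C = insert e (sym_diff A C)"
      using e by auto
    then have "card (insert e A) + card (sym_diff (insert e A) C) =
        card A + card (sym_diff A C) + 2"
      using fin e by simp
    then show ?thesis by (simp only: floor_half_sign_add_2 add.right_inverse)
  qed
  then have "(\<Sum>A\<in>Pow E. floor_half_sign (card A + card (sym_diff A C))) = 0"
    unfolding sum_Pow_split[OF assms(1) e(1)] by (intro sum.neutral ballI)
  then show ?thesis using False by simp
qed

text \<open>The map is an involution. It replaces the pair \<open>(A, B)\<close> by the free
  coordinates \<open>A\<close> and \<open>C = sym_diff A B\<close>, so that a condition on
  \<open>C\<close> alone selects a product set.\<close>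

lemma bij_betw_sym_diff_pairs:
  "bij_betw (\<lambda>(A, C). (A, sym_diff A C)) (Pow E \<times> {C \<in> Pow E. P C})
     {(A, B). (A, B) \<in> Pow E \<times> Pow E \<and> P (sym_diff A B)}"
proof -
  have "sym_diff A (sym_diff A C) = C" for A C :: "'a set" by auto
  then show ?thesis
    by (intro bij_betw_byWitness[where f' = "\<lambda>(A, C). (A, sym_diff A C)"]) auto
qed

text \<open>Serves both biases: \<open>P\<close> is constantly true for the unconditional one and is
  \<open>eulerian V ends\<close> for the conditional one.\<close>

lemma sum_floor_half_sign_pairs:
  assumes "finite E"
  shows "(\<Sum>(A, B) | (A, B) \<in> Pow E \<times> Pow E \<and> P (sym_diff A B). floor_half_sign (card A + card B)) =
    (if P E then 2 ^ card E * floor_half_sign (card E) else 0)"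
proof -
  have "(\<Sum>(A, B) | (A, B) \<in> Pow E \<times> Pow E \<and> P (sym_diff A B). floor_half_sign (card A + card B)) =
      (\<Sum>(A, C)\<in>Pow E \<times> {C \<in> Pow E. P C}. floor_half_sign (card A + card (sym_diff A C)))"
    by (subst sum.reindex_bij_betw[OF bij_betw_sym_diff_pairs, symmetric])
      (simp add: case_prod_unfold)
  also have "\<dots> = (\<Sum>C | C \<in> Pow E \<and> P C. \<Sum>A\<in>Pow E. floor_half_sign (card A + card (sym_diff A C)))"
    by (simp only: sum.cartesian_product[symmetric]) (rule sum.swap)
  also have "\<dots> = (\<Sum>C | C \<in> Pow E \<and> P C. if C = E then 2 ^ card E * floor_half_sign (card E) else 0)"
    by (intro sum.cong refl sum_floor_half_sign_sym_diff assms) simp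
  also have "\<dots> = (if P E then 2 ^ card E * floor_half_sign (card E) else 0)"
    using assms by (subst sum.delta) auto
  finally show ?thesis .
qed

section \<open>Counting eulerian edge sets\<close>

text \<open>The two summands of \<open>degree\<close> count the union and the intersection of the
  edges leaving and entering \<open>v\<close>; the intersection consists of the loops at
  \<open>v\<close>.\<close>

lemma degree_eq_out_plus_in:
  assumes "orientation E ends tail head" "finite A" "A \<subseteq> E"
  shows "degree ends A v = card {e \<in> A. tail e = v} + card {e \<in> A. head e = v}"
proof -
  have ends: "ends e = {tail e, head e}" if "e \<in> A" for e
    using assms that by (auto simp: orientation_def)
  have "{e \<in> A. v \<in> ends e} = {e \<in> A. tail e = v} \<union> {e \<in> A. head e = v}"
    "{e \<in> A. ends e = {v}} = {e \<in> A. tail e = v} \<inter> {e \<in> A. head e = v}"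
    using ends by auto
  then show ?thesis
    using assms(2) by (simp add: degree_def card_Un_Int[symmetric])
qed

lemma minus_one_power_card_filter:
  assumes "finite A"
  shows "(- 1 :: 'a::comm_ring_1) ^ card {x \<in> A. P x} = (\<Prod>x\<in>A. if P x then - 1 else 1)"
  using assms by (simp add: prod.If_cases Int_def)

lemma sum_Pow_prod:
  fixes f :: "'a \<Rightarrow> 'b::comm_semiring_1"
  assumes "finite S"
  shows "(\<Sum>X\<in>Pow S. \<Prod>x\<in>X. f x) = (\<Prod>x\<in>S. f x + 1)"
  using assms by (simp add: prod_add)

text \<open>A single sign -1 gives a factor 0. This turns a sum of signs over all subsets into an
  indicator.\<close>

lemma prod_one_plus_sign:
  assumes "finite S"
  shows "(\<Prod>x\<in>S. (if P x then 1 else - 1) + 1 :: int) = (if \<forall>x\<in>S. P x then 2 ^ card S else 0)"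
  using assms by auto

lemma card_eulerian_double_count:
  fixes V :: "'v set" and E :: "'e set"
  assumes "finite V" "finite E" "orientation E ends tail head"
  shows "2 ^ card V * card {A \<in> Pow E. eulerian V ends A} =
    2 ^ card E * card {X \<in> Pow V. \<forall>e\<in>E. tail e \<in> X \<longleftrightarrow> head e \<in> X}"
proof -
  define s :: "'e \<Rightarrow> 'v \<Rightarrow> int" where
    "s e v = (if tail e = v then - 1 else 1) * (if head e = v then - 1 else 1)" for e v
  have by_vertex: "(\<Prod>e\<in>A. s e v) = (if even (degree ends A v) then 1 else - 1)"
    if "A \<in> Pow E" for A v
  proof -
    have A: "finite A" "A \<subseteq> E" using that assms(2) by (auto intro: finite_subset)
    have "(\<Prod>e\<in>A. s e v) = (- 1) ^ degree ends A v"
      by (simp add: degree_eq_out_plus_in[OF assms(3) A] power_add s_def prod.distrib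
          minus_one_power_card_filter A)
    then show ?thesis by simp
  qed
  have by_edge: "(\<Prod>v\<in>X. s e v) = (if tail e \<in> X \<longleftrightarrow> head e \<in> X then 1 else - 1)"
    if "X \<in> Pow V" for X e
  proof -
    have "finite X" using that assms(1) by (auto intro: finite_subset)
    then show ?thesis by (auto simp: s_def prod.distrib prod.delta)
  qed
  have "(\<Sum>A\<in>Pow E. \<Sum>X\<in>Pow V. \<Prod>v\<in>X. \<Prod>e\<in>A. s e v) =
      (\<Sum>A\<in>Pow E. \<Prod>v\<in>V. (\<Prod>e\<in>A. s e v) + 1)"
    by (simp add: sum_Pow_prod assms(1))
  also have "\<dots> = (\<Sum>A\<in>Pow E. if eulerian V ends A then 2 ^ card V else 0)"
    by (intro sum.cong refl) (simp add: by_vertex prod_one_plus_sign assms(1) eulerian_def)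
  also have "\<dots> = 2 ^ card V * int (card {A \<in> Pow E. eulerian V ends A})"
    using assms(2) by (simp add: sum.If_cases Int_def)
  finally have 1: "(\<Sum>A\<in>Pow E. \<Sum>X\<in>Pow V. \<Prod>v\<in>X. \<Prod>e\<in>A. s e v) =
      2 ^ card V * int (card {A \<in> Pow E. eulerian V ends A})" .
  have "(\<Sum>A\<in>Pow E. \<Sum>X\<in>Pow V. \<Prod>v\<in>X. \<Prod>e\<in>A. s e v) =
      (\<Sum>X\<in>Pow V. \<Sum>A\<in>Pow E. \<Prod>e\<in>A. \<Prod>v\<in>X. s e v)"
    by (subst sum.swap) (intro sum.cong refl prod.swap)
  also have "\<dots> = (\<Sum>X\<in>Pow V. \<Prod>e\<in>E. (\<Prod>v\<in>X. s e v) + 1)"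
    by (simp add: sum_Pow_prod assms(2))
  also have "\<dots> = (\<Sum>X\<in>Pow V. if \<forall>e\<in>E. tail e \<in> X \<longleftrightarrow> head e \<in> X then 2 ^ card E else 0)"
    by (intro sum.cong refl) (simp only: by_edge prod_one_plus_sign assms(2))
  also have "\<dots> = 2 ^ card E * int (card {X \<in> Pow V. \<forall>e\<in>E. tail e \<in> X \<longleftrightarrow> head e \<in> X})"
    using assms(1) by (simp add: sum.If_cases Int_def)
  finally have "int (2 ^ card V * card {A \<in> Pow E. eulerian V ends A}) =
      int (2 ^ card E * card {X \<in> Pow V. \<forall>e\<in>E. tail e \<in> X \<longleftrightarrow> head e \<in> X})"
    using 1 by simp
  then show ?thesis by (simp only: of_nat_eq_iff)
qed

lemma equiv_connected_rel: "equiv V (connected_rel V E ends)"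
proof -
  have "sym ({(u, v). \<exists>e\<in>E. ends e = {u, v}}\<^sup>*)"
    by (rule sym_rtrancl) (auto simp: sym_def insert_commute)
  then show ?thesis
    by (auto simp: equiv_def refl_on_def sym_def trans_def connected_rel_def)
qed

lemma card_uncut_sets:
  assumes "finite_multigraph V E ends" "orientation E ends tail head"
  shows "card {X \<in> Pow V. \<forall>e\<in>E. tail e \<in> X \<longleftrightarrow> head e \<in> X} = 2 ^ num_components V E ends"
proof -
  define R where "R = connected_rel V E ends"
  interpret finite_multigraph V E ends by fact
  have eq: "equiv V R" unfolding R_def by (rule equiv_connected_rel)
  have edge: "(tail e, head e) \<in> R" if "e \<in> E" for e
    using assms(2) ends_V that
    by (fastforce simp: R_def connected_rel_def orientation_def)
  have closed: "y \<in> X" if "(x, y) \<in> R" "x \<in> X" "\<forall>e\<in>E. tail e \<in> X \<longleftrightarrow> head e \<in> X" for x y X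
  proof -
    have "(x, y) \<in> {(u, v). \<exists>e\<in>E. ends e = {u, v}}\<^sup>*"
      using that(1) by (simp add: R_def connected_rel_def)
    then show ?thesis
    proof induction
      case base
      then show ?case by fact
    next
      case (step y z)
      then obtain e where "e \<in> E" "{tail e, head e} = {y, z}"
        using assms(2) by (auto simp: orientation_def)
      then show ?case using step.IH that(3) by (auto simp: doubleton_eq_iff)
    qed
  qed
  have "bij_betw (\<lambda>\<C>. \<Union>\<C>) (Pow (V // R)) {X \<in> Pow V. \<forall>e\<in>E. tail e \<in> X \<longleftrightarrow> head e \<in> X}"
  proof (rule bij_betw_byWitness[where f' = "\<lambda>X. X // R"])
    show "\<forall>\<C>\<in>Pow (V // R). \<Union>\<C> // R = \<C>"
    proof
      fix \<C> assume "\<C> \<in> Pow (V // R)"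
      then have \<C>: "C \<in> V // R" if "C \<in> \<C>" for C using that by auto
      have "R `` {x} = C" if "C \<in> \<C>" "x \<in> C" for C x
        using \<C>[OF that(1)] that(2) eq
        by (metis Image_singleton_iff equiv_class_eq quotientE)
      moreover have "\<exists>x. x \<in> C" if "C \<in> \<C>" for C
        using in_quotient_imp_non_empty[OF eq \<C>[OF that]] by auto
      ultimately show "\<Union>\<C> // R = \<C>"
        unfolding quotient_def by fastforce
    qed
    show "\<forall>X\<in>{X \<in> Pow V. \<forall>e\<in>E. tail e \<in> X \<longleftrightarrow> head e \<in> X}. \<Union>(X // R) = X"
    proof
      fix X assume X: "X \<in> {X \<in> Pow V. \<forall>e\<in>E. tail e \<in> X \<longleftrightarrow> head e \<in> X}"
      show "\<Union>(X // R) = X"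
      proof
        show "\<Union>(X // R) \<subseteq> X" using X closed by (auto simp: quotient_def)
        show "X \<subseteq> \<Union>(X // R)"
          using X equiv_class_self[OF eq] by (auto simp: quotient_def)
      qed
    qed
    show "(\<lambda>\<C>. \<Union>\<C>) ` Pow (V // R) \<subseteq> {X \<in> Pow V. \<forall>e\<in>E. tail e \<in> X \<longleftrightarrow> head e \<in> X}"
    proof safe
      fix \<C> C x assume "\<C> \<subseteq> V // R" "C \<in> \<C>" "x \<in> C"
      then show "x \<in> V" using Union_quotient[OF eq] by blast
    next
      fix \<C> e C assume *: "\<C> \<subseteq> V // R" "e \<in> E" "C \<in> \<C>"
      then show "head e \<in> \<Union>\<C>" if "tail e \<in> C"
        using in_quotient_imp_closed[OF eq _ that edge] that by blast
      have "(head e, tail e) \<in> R" using edge[OF *(2)] eq by (meson equivE symD)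
      then show "tail e \<in> \<Union>\<C>" if "head e \<in> C"
        using * in_quotient_imp_closed[OF eq _ that] by blast
    qed
    show "(\<lambda>X. X // R) ` {X \<in> Pow V. \<forall>e\<in>E. tail e \<in> X \<longleftrightarrow> head e \<in> X} \<subseteq> Pow (V // R)"
      by (auto simp: quotient_def)
  qed
  then have "card {X \<in> Pow V. \<forall>e\<in>E. tail e \<in> X \<longleftrightarrow> head e \<in> X} = card (Pow (V // R))"
    by (simp add: bij_betw_same_card)
  moreover have "finite (V // R)"
    using finite_V by (simp add: quotient_def)
  ultimately show ?thesis
    by (simp add: card_Pow num_components_def R_def)
qed

lemma card_eulerian:
  assumes "finite_multigraph V E ends" "orientation E ends tail head"
  shows "2 ^ graph_rank V E ends * card {A \<in> Pow E. eulerian V ends A} = 2 ^ card E"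
proof -
  interpret finite_multigraph V E ends by fact
  let ?k = "num_components V E ends" and ?N = "card {A \<in> Pow E. eulerian V ends A}"
  have "V // connected_rel V E ends = (\<lambda>x. connected_rel V E ends `` {x}) ` V"
    by (auto simp: quotient_def)
  then have "?k \<le> card V"
    by (simp add: num_components_def card_image_le finite_V)
  then have "2 ^ card V = 2 ^ graph_rank V E ends * (2 ^ ?k :: nat)"
    by (simp add: graph_rank_def power_add[symmetric])
  then have "2 ^ ?k * (2 ^ graph_rank V E ends * ?N) = 2 ^ ?k * (2 ^ card E :: nat)"
    using card_eulerian_double_count[OF finite_V finite_E assms(2)] card_uncut_sets[OF assms]
    by (simp add: ac_simps)
  then show ?thesis by simp
qed

lemma num_nowhere_zero_flows_2:
  assumes "finite E" "orientation E ends tail head"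
  shows "num_nowhere_zero_flows V E tail head 2 = (if eulerian V ends E then 1 else 0)"
proof -
  define g where "g = (\<lambda>e\<in>E. 1 :: int)"
  have only_g: "f = g" if "f \<in> E \<rightarrow>\<^sub>E {0..<int 2}" "\<forall>e\<in>E. f e \<noteq> 0" for f
  proof (rule extensionalityI[of _ E])
    fix e assume "e \<in> E"
    then have "f e \<in> {0..<int 2}" "f e \<noteq> 0" using that by auto
    then show "f e = g e" using \<open>e \<in> E\<close> by (simp add: g_def)
  qed (use that in \<open>auto simp: g_def PiE_def\<close>)
  have sum_g: "(\<Sum>e | e \<in> E \<and> P e. g e) = int (card {e \<in> E. P e})" for P
    by (simp add: g_def)
  have "int m mod 2 = int n mod 2 \<longleftrightarrow> even (m + n)" for m n
    by presburger
  then have flow_g: "(\<forall>v\<in>V. (\<Sum>e | e \<in> E \<and> tail e = v. g e) mod int 2 =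
      (\<Sum>e | e \<in> E \<and> head e = v. g e) mod int 2) \<longleftrightarrow> eulerian V ends E"
    unfolding sum_g eulerian_def degree_eq_out_plus_in[OF assms(2,1) subset_refl] by simp
  have g: "g \<in> E \<rightarrow>\<^sub>E {0..<int 2}" "\<forall>e\<in>E. g e \<noteq> 0"
    by (auto simp: g_def)
  have "f = g \<and> eulerian V ends E" if "f \<in> nowhere_zero_flows V E tail head 2" for f
  proof -
    have "f = g" using that by (intro only_g) (simp_all add: nowhere_zero_flows_def)
    moreover from this have "eulerian V ends E"
      using that by (simp only: nowhere_zero_flows_def mem_Collect_eq flow_g)
    ultimately show ?thesis by simp
  qed
  moreover have "g \<in> nowhere_zero_flows V E tail head 2" if "eulerian V ends E"
    unfolding nowhere_zero_flows_def mem_Collect_eq flow_g using g that by blast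
  ultimately have "nowhere_zero_flows V E tail head 2 = (if eulerian V ends E then {g} else {})"
    unfolding if_split[of "(=) _"] by blast
  then show ?thesis
    by (simp add: num_nowhere_zero_flows_def)
qed

theorem theorem2p18:
  fixes V :: "'v set" and E :: "'e set" and ends :: "'e \<Rightarrow> 'v set"
    and tail head :: "'e \<Rightarrow> 'v"
    and \<Sigma> \<Delta> :: "'e set \<times> 'e set \<Rightarrow> bool"
  assumes "finite_multigraph V E ends"
    and "orientation E ends tail head"
  defines "\<Sigma> \<equiv> (\<lambda>(A, B). (card A + card B) mod 4 \<in> {0, 1})"
    and "\<Delta> \<equiv> (\<lambda>(A, B). eulerian V ends (sym_diff A B))"
  shows "\<P>(\<omega> in random_edge_sets E. \<Delta> \<omega>) > 0 \<and>
    bias (random_edge_sets E) \<Sigma> \<noteq> 0 \<and>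
    cond_bias (random_edge_sets E) \<Sigma> \<Delta> / bias (random_edge_sets E) \<Sigma> =
      2 ^ graph_rank V E ends * real (num_nowhere_zero_flows V E tail head 2)"
proof -
  interpret finite_multigraph V E ends by fact
  define S where "S = Pow E \<times> Pow E"
  define N where "N = card {A \<in> Pow E. eulerian V ends A}"
  have S: "finite S" "S \<noteq> {}" "card S = 2 ^ card E * 2 ^ card E"
    using finite_E by (auto simp: S_def card_cartesian_product card_Pow)
  have res: "random_edge_sets E = pmf_of_set S"
    unfolding random_edge_sets_def S_def using finite_E
    by (intro pair_pmf_of_set) auto
  have S\<Delta>: "{\<omega> \<in> S. \<Delta> \<omega>} = {(A, B). (A, B) \<in> Pow E \<times> Pow E \<and> eulerian V ends (sym_diff A B)}"
    by (auto simp: S_def \<Delta>_def)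
  have card_\<Delta>: "card {\<omega> \<in> S. \<Delta> \<omega>} = 2 ^ card E * N"
    using bij_betw_same_card[OF bij_betw_sym_diff_pairs[of E "eulerian V ends"]] finite_E
    by (simp add: S\<Delta> card_cartesian_product card_Pow N_def)
  have rank: "2 ^ graph_rank V E ends * real N = 2 ^ card E"
    using arg_cong[OF card_eulerian[OF assms(1,2)], of real] by (simp add: N_def)
  then have N: "real N > 0"
    by (cases "N = 0") auto
  have sign: "(if \<Sigma> \<omega> then 1 else - 1) = (case \<omega> of (A, B) \<Rightarrow> floor_half_sign (card A + card B))" for \<omega>
    by (simp add: \<Sigma>_def case_prod_unfold)
  have S_True: "S = {(A, B). (A, B) \<in> Pow E \<times> Pow E \<and> True}"
    by (auto simp: S_def)
  have "(\<Sum>\<omega>\<in>S. if \<Sigma> \<omega> then 1 else - 1 :: real) = 2 ^ card E * floor_half_sign (card E)"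
    unfolding sign S_True
    by (rule sum_floor_half_sign_pairs[OF finite_E, of "\<lambda>_. True", unfolded if_True])
  then have bias: "bias (random_edge_sets E) \<Sigma> = floor_half_sign (card E) / 2 ^ card E"
    by (simp only: res bias_pmf_of_set[OF S(1,2)] S(3)) simp
  have "(\<Sum>\<omega>\<in>{\<omega> \<in> S. \<Delta> \<omega>}. if \<Sigma> \<omega> then 1 else - 1 :: real) =
      (if eulerian V ends E then 2 ^ card E * floor_half_sign (card E) else 0)"
    unfolding sign S\<Delta> by (rule sum_floor_half_sign_pairs[OF finite_E])
  then have cond_bias: "cond_bias (random_edge_sets E) \<Sigma> \<Delta> =
      (if eulerian V ends E then floor_half_sign (card E) / N else 0)"
    by (simp only: res cond_bias_pmf_of_set[OF S(1,2)] card_\<Delta>) simp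
  have "\<P>(\<omega> in random_edge_sets E. \<Delta> \<omega>) =
      real (card {\<omega> \<in> S. \<Delta> \<omega>}) / real (card S)"
    using S by (simp add: res measure_pmf_of_set Int_def)
  then have "\<P>(\<omega> in random_edge_sets E. \<Delta> \<omega>) > 0"
    using N by (simp add: card_\<Delta> S(3))
  moreover have "bias (random_edge_sets E) \<Sigma> \<noteq> 0"
    by (simp add: bias)
  moreover have "cond_bias (random_edge_sets E) \<Sigma> \<Delta> / bias (random_edge_sets E) \<Sigma> =
      2 ^ graph_rank V E ends * real (num_nowhere_zero_flows V E tail head 2)"
    using N by (simp add: bias cond_bias num_nowhere_zero_flows_2[OF finite_E assms(2)]
        rank[symmetric])
  ultimately show ?thesis by blast
qed

end
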